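(* The space $\mathbb{G}^{\mathbb{N}}$, equipped with the increasing sequence of semi-norms $\{\|\cdot\|_n\}_{n\in\mathbb{N}}$ constructed in the context from the universal operator $\pi$ on the Gurariĭ space $\mathbb{G}$, is of almost universal disposition for finite-dimensional graded Fréchet spaces. That is: for every $\varepsilon>0$, for all finite-dimensional graded Fréchet spaces $X\subseteq Y$ and every isometric embedding $f_0\colon X\to\mathbb{G}^{\mathbb{N}}$ there exists an $\varepsilon$-isometric embedding $f\colon Y\to\mathbb{G}^{\mathbb{N}}$ with $f\restriction X=f_0$.
   Context: A Fréchet space is a complete metrizable locally convex space; it is always considered with a fixed sequence of semi-norms $\{\|\cdot\|_i\}_{i\in\mathbb{N}}$ generating its topology. It is called graded if $\|\cdot\|_1\le\|\cdot\|_2\le\cdots$. Writing $X\subseteq Y$ for Fréchet spaces means that $X$ is a linear subspace of $Y$ whose $i$-th semi-norm is the restriction of the $i$-th semi-norm of $Y$, for every $i$. A linear embedding $f\colon X\to Y$ between Fréchet spaces is an $\varepsilon$-isometric embedding if $(1+\varepsilon)^{-1}\|x\|_i\le\|f(x)\|_i\le(1+\varepsilon)\|x\|_i$ for all $i\in\mathbb{N}$ and $x\in X$; it is an isometric embedding if $\|f(x)\|_i=\|x\|_i$ for all $i\in\mathbb{N}$ and $x\in X$. For normed spaces, ($\varepsilon$-)isometric embeddings are the linear maps satisfying the same conditions for the single norm. The Gurariĭ space $\mathbb{G}$ is the separable Banach space, unique up to linear isometry, such that for every $\varepsilon>0$, all finite-dimensional normed spaces $E\subseteq F$ and every isometric embedding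 $e\colon E\to\mathbb{G}$ there is an $\varepsilon$-isometric embedding $f\colon F\to\mathbb{G}$ with $f\restriction E=e$. The universal operator. It is known that there is a non-expansive (norm at most $1$) linear operator $\pi\colon\mathbb{G}\to\mathbb{G}$ such that: (1) for every separable Banach space $X$ and every non-expansive operator $T\colon X\to\mathbb{G}$ there is an isometric embedding $i\colon X\to\mathbb{G}$ with $T=\pi\circ i$; (2) for every $\varepsilon>0$, all finite-dimensional normed spaces $E\subseteq F$, every non-expansive linear operator $T\colon F\to\mathbb{G}$ and every isometric embedding $e\colon E\to\mathbb{G}$ with $T\restriction E=\pi\circ e$, there is an $\varepsilon$-isometric embedding $f\colon F\to\mathbb{G}$ with $\|f\restriction E-e\|\le\varepsilon$ and $\|\pi\circ f-T\|\le\varepsilon$; and $\ker\pi$ is linearly isometric to $\mathbb{G}$. Applying (1) to $T=\mathrm{id}_{\mathbb{G}}$ gives an isometric embedding $j\colon\mathbb{G}\to\mathbb{G}$ with $\pi\circ j=\mathrm{id}_{\mathbb{G}}$, so $\mathbb{G}=j(\mathbb{G})\oplus\ker\pi$. Fix such $\pi$, $j$ and a surjective linear isometry $\kappa\colon\ker\pi\to\mathbb{G}$. The semi-norms. Let $\|\cdot\|_1$ be the norm of $\mathbb{G}$ on $\mathbb{G}^1=\mathbb{G}$ and $\varphi_1=\mathrm{id}_{\mathbb{G}}$. Given a norm $\|\cdot\|_{n-1}$ on $\mathbb{G}^{n-1}$ and a surjective linear isometry $\varphi_{n-1}\colon\mathbb{G}\to(\mathbb{G}^{n-1},\|\cdot\|_{n-1})$,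 let $\varphi_n\colon\mathbb{G}\to\mathbb{G}^{n-1}\times\mathbb{G}=\mathbb{G}^n$ be the linear bijection $\varphi_n(z)=(\varphi_{n-1}(\pi(z)),\kappa(z-j(\pi(z))))$, and let $\|\cdot\|_n$ be the norm on $\mathbb{G}^n$ making $\varphi_n$ an isometry. Thus $(\mathbb{G}^n,\|\cdot\|_n)$ is isometric to $\mathbb{G}$, and the projection $\pi_n\colon\mathbb{G}^n\to\mathbb{G}^{n-1}$ onto the first $n-1$ components corresponds to $\pi$ under these isometries, hence is non-expansive. For $x=(x_k)_{k}\in\mathbb{G}^{\mathbb{N}}$ put $\|x\|_n=\|(x_1,\dots,x_n)\|_n$. Then $\|\cdot\|_1\le\|\cdot\|_2\le\cdots$ and these semi-norms generate the product topology. *)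

theory Defs
  imports
    "HOL-Analysis.Analysis"
    "HOL-Analysis.Finite_Function_Topology"
    "HOL-Library.Function_Algebras"
begin

(* The library gives function spaces their pointwise addition only. *)
instantiation "fun" :: (type, real_vector) real_vector
begin

definition scaleR_fun :: "real \<Rightarrow> ('a \<Rightarrow> 'b) \<Rightarrow> 'a \<Rightarrow> 'b" where
  "scaleR_fun c f = (\<lambda>x. c *\<^sub>R f x)"

instance
  by standard (simp_all add: scaleR_fun_def fun_eq_iff algebra_simps)

end

(* Spaces are linear subspaces V of an ambient real vector space; norms and seminorms are
   functions on the ambient type of which only the values on V are relevant. *)

definition finite_dim :: "'v::real_vector set \<Rightarrow> bool" where
  "finite_dim V \<longleftrightarrow> (\<exists>B. finite B \<and> span B = V)"

definition linear_on :: "'v::real_vector set \<Rightarrow> ('v \<Rightarrow> 'w::real_vector) \<Rightarrow> bool" where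
  "linear_on V f \<longleftrightarrow>
     (\<forall>x\<in>V. \<forall>y\<in>V. f (x + y) = f x + f y) \<and> (\<forall>c. \<forall>x\<in>V. f (c *\<^sub>R x) = c *\<^sub>R f x)"

definition seminorm_on :: "'v::real_vector set \<Rightarrow> ('v \<Rightarrow> real) \<Rightarrow> bool" where
  "seminorm_on V s \<longleftrightarrow>
     (\<forall>x\<in>V. 0 \<le> s x) \<and>
     (\<forall>x\<in>V. \<forall>y\<in>V. s (x + y) \<le> s x + s y) \<and> (\<forall>c. \<forall>x\<in>V. s (c *\<^sub>R x) = \<bar>c\<bar> * s x)"

definition seminorm_topology :: "'v::real_vector set \<Rightarrow> (nat \<Rightarrow> 'v \<Rightarrow> real) \<Rightarrow> 'v topology" where
  "seminorm_topology V p =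
     topology_generated_by {{y \<in> V. p i (y - x) < r} | x i r. x \<in> V \<and> 0 < r}"

definition seminorm_complete :: "'v::real_vector set \<Rightarrow> (nat \<Rightarrow> 'v \<Rightarrow> real) \<Rightarrow> bool" where
  "seminorm_complete V p \<longleftrightarrow>
     (\<forall>s::nat \<Rightarrow> 'v. (\<forall>n. s n \<in> V) \<and>
        (\<forall>i. \<forall>e>0. \<exists>M. \<forall>m\<ge>M. \<forall>n\<ge>M. p i (s m - s n) < e) \<longrightarrow>
        (\<exists>l. limitin (seminorm_topology V p) s l sequentially))"

(* The index i = 0, 1, 2, ... stands for the (i+1)-st seminorm. *)
definition frechet_space :: "'v::real_vector set \<Rightarrow> (nat \<Rightarrow> 'v \<Rightarrow> real) \<Rightarrow> bool" where
  "frechet_space V p \<longleftrightarrow>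
     subspace V \<and> (\<forall>i. seminorm_on V (p i)) \<and>
     metrizable_space (seminorm_topology V p) \<and> seminorm_complete V p"

definition graded :: "'v::real_vector set \<Rightarrow> (nat \<Rightarrow> 'v \<Rightarrow> real) \<Rightarrow> bool" where
  "graded V p \<longleftrightarrow> (\<forall>i. \<forall>x\<in>V. p i x \<le> p (Suc i) x)"

definition frechet_isometric_embedding ::
  "'v::real_vector set \<Rightarrow> (nat \<Rightarrow> 'v \<Rightarrow> real) \<Rightarrow> (nat \<Rightarrow> 'w::real_vector \<Rightarrow> real) \<Rightarrow> ('v \<Rightarrow> 'w) \<Rightarrow> bool"
where
  "frechet_isometric_embedding V p q f \<longleftrightarrow>
     linear_on V f \<and> inj_on f V \<and> (\<forall>i. \<forall>x\<in>V. q i (f x) = p i x)"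

definition frechet_eps_isometric_embedding ::
  "real \<Rightarrow> 'v::real_vector set \<Rightarrow> (nat \<Rightarrow> 'v \<Rightarrow> real) \<Rightarrow> (nat \<Rightarrow> 'w::real_vector \<Rightarrow> real) \<Rightarrow>
   ('v \<Rightarrow> 'w) \<Rightarrow> bool"
where
  "frechet_eps_isometric_embedding \<epsilon> V p q f \<longleftrightarrow>
     linear_on V f \<and> inj_on f V \<and>
     (\<forall>i. \<forall>x\<in>V. inverse (1 + \<epsilon>) * p i x \<le> q i (f x) \<and> q i (f x) \<le> (1 + \<epsilon>) * p i x)"

definition normed_space_on :: "'v::real_vector set \<Rightarrow> ('v \<Rightarrow> real) \<Rightarrow> bool" where
  "normed_space_on V N \<longleftrightarrow> subspace V \<and> seminorm_on V N \<and> (\<forall>x\<in>V. N x = 0 \<longrightarrow> x = 0)"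

definition separable_banach_space_on :: "'v::real_vector set \<Rightarrow> ('v \<Rightarrow> real) \<Rightarrow> bool" where
  "separable_banach_space_on V N \<longleftrightarrow>
     normed_space_on V N \<and> seminorm_complete V (\<lambda>_. N) \<and>
     separable_space (seminorm_topology V (\<lambda>_. N))"

definition isometric_embedding ::
  "'v::real_vector set \<Rightarrow> ('v \<Rightarrow> real) \<Rightarrow> ('v \<Rightarrow> 'g::real_normed_vector) \<Rightarrow> bool"
where
  "isometric_embedding V N f \<longleftrightarrow> linear_on V f \<and> (\<forall>x\<in>V. norm (f x) = N x)"

definition eps_isometric_embedding ::
  "real \<Rightarrow> 'v::real_vector set \<Rightarrow> ('v \<Rightarrow> real) \<Rightarrow> ('v \<Rightarrow> 'g::real_normed_vector) \<Rightarrow> bool"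
where
  "eps_isometric_embedding \<epsilon> V N f \<longleftrightarrow>
     linear_on V f \<and>
     (\<forall>x\<in>V. inverse (1 + \<epsilon>) * N x \<le> norm (f x) \<and> norm (f x) \<le> (1 + \<epsilon>) * N x)"

definition opnorm_le ::
  "'v set \<Rightarrow> ('v \<Rightarrow> real) \<Rightarrow> ('v \<Rightarrow> 'g::real_normed_vector) \<Rightarrow> real \<Rightarrow> bool"
where
  "opnorm_le V N A c \<longleftrightarrow> (\<forall>x\<in>V. norm (A x) \<le> c * N x)"

definition nonexpansive_operator ::
  "'v::real_vector set \<Rightarrow> ('v \<Rightarrow> real) \<Rightarrow> ('v \<Rightarrow> 'g::real_normed_vector) \<Rightarrow> bool"
where
  "nonexpansive_operator V N T \<longleftrightarrow> linear_on V T \<and> opnorm_le V N T 1"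

(* A quantifier over all finite-dimensional normed (or separable Banach) spaces cannot range
   over types.  The free real vector space on a set of continuum size contains a linearly
   isomorphic copy of every real vector space of dimension at most the continuum, hence of
   every separable Banach space; so it suffices to let the spaces range over its subspaces,
   each with an arbitrary norm. *)
type_synonym univ_vs = "real \<Rightarrow>\<^sub>0 real"

definition gurarii_space :: "'g::banach itself \<Rightarrow> bool" where
  "gurarii_space (_ :: 'g itself) \<longleftrightarrow>
     separable_space (euclidean :: 'g topology) \<and>
     (\<forall>\<epsilon>>0. \<forall>(E :: univ_vs set) F N (e :: univ_vs \<Rightarrow> 'g).
        finite_dim F \<and> normed_space_on F N \<and> subspace E \<and> E \<subseteq> F \<and> isometric_embedding E N e \<longrightarrow>
        (\<exists>f. eps_isometric_embedding \<epsilon> F N f \<and> (\<forall>x\<in>E. f x = e x)))"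

definition universal_operator :: "('g::banach \<Rightarrow> 'g) \<Rightarrow> bool" where
  "universal_operator \<pi> \<longleftrightarrow>
     nonexpansive_operator UNIV norm \<pi> \<and>
     (\<forall>(X :: univ_vs set) N T.
        separable_banach_space_on X N \<and> nonexpansive_operator X N T \<longrightarrow>
        (\<exists>i. isometric_embedding X N i \<and> (\<forall>x\<in>X. T x = \<pi> (i x)))) \<and>
     (\<forall>\<epsilon>>0. \<forall>(E :: univ_vs set) F N T e.
        finite_dim F \<and> normed_space_on F N \<and> subspace E \<and> E \<subseteq> F \<and>
        nonexpansive_operator F N T \<and> isometric_embedding E N e \<and> (\<forall>x\<in>E. T x = \<pi> (e x)) \<longrightarrow>
        (\<exists>f. eps_isometric_embedding \<epsilon> F N f \<and>
             opnorm_le E N (\<lambda>x. f x - e x) \<epsilon> \<and>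
             opnorm_le F N (\<lambda>x. \<pi> (f x) - T x) \<epsilon>))"

(* The power of G with n+1 factors is encoded as the set of sequences (x k) with x k = 0 for
   k > n; "phi pi j kappa n" is the linear bijection from G onto it, with indices starting
   at 0. *)
fun phi :: "('g::real_normed_vector \<Rightarrow> 'g) \<Rightarrow> ('g \<Rightarrow> 'g) \<Rightarrow> ('g \<Rightarrow> 'g) \<Rightarrow> nat \<Rightarrow> 'g \<Rightarrow> (nat \<Rightarrow> 'g)" where
  "phi \<pi> j \<kappa> 0 z = (\<lambda>k. if k = 0 then z else 0)"
| "phi \<pi> j \<kappa> (Suc n) z = (phi \<pi> j \<kappa> n (\<pi> z)) (Suc n := \<kappa> (z - j (\<pi> z)))"

definition power_norm ::
  "('g::real_normed_vector \<Rightarrow> 'g) \<Rightarrow> ('g \<Rightarrow> 'g) \<Rightarrow> ('g \<Rightarrow> 'g) \<Rightarrow> nat \<Rightarrow> (nat \<Rightarrow> 'g) \<Rightarrow> real"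
where
  "power_norm \<pi> j \<kappa> n y = norm (inv (phi \<pi> j \<kappa> n) y)"

definition power_seminorm ::
  "('g::real_normed_vector \<Rightarrow> 'g) \<Rightarrow> ('g \<Rightarrow> 'g) \<Rightarrow> ('g \<Rightarrow> 'g) \<Rightarrow> nat \<Rightarrow> (nat \<Rightarrow> 'g) \<Rightarrow> real"
where
  "power_seminorm \<pi> j \<kappa> n x = power_norm \<pi> j \<kappa> n (\<lambda>k. if k \<le> n then x k else 0)"

end

theory Submission
  imports Defs
begin

text \<open>
  Write \<open>G\<close> for the ambient Banach space. The bijections \<open>\<phi>\<^sub>n\<close> turn the truncations of a sequence
  \<open>x\<close> into elements \<open>level n x\<close> of \<open>G\<close>, and these form a thread:
  \<open>\<pi> (level (n + 1) x) = level n x\<close>. Every thread arises from exactly one sequence, and the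
  \<open>n\<close>-th seminorm of \<open>x\<close> is the norm of \<open>level n x\<close>. So the sequence space is the inverse limit of
  the chain \<open>G \<leftarrow> G \<leftarrow> \<dots>\<close> with all maps equal to \<open>\<pi>\<close>, and an operator into it is the same as a
  sequence of operators \<open>F n\<close> into \<open>G\<close> with \<open>\<pi> \<circ> F (n + 1) = F n\<close>. Extending the given
  embedding therefore means lifting through \<open>\<pi>\<close> infinitely often, with \<^emph>\<open>exact\<close> commutation and
  exact prescribed values on \<open>X\<close> each time.

  The defining property of the universal operator only gives lifts that commute and extend
  up to a small error. Both errors can be removed (\<open>universal_operator_exact_lifting\<close>). The
  right inverse \<open>j\<close> of \<open>\<pi>\<close> pulls the error \<open>\<pi> \<circ> f - T\<close> back to \<open>G\<close>, where it can be
  subtracted. What is then left of the error on \<open>E\<close> has values in the kernel of \<open>\<pi>\<close>, so after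
  composition with a bounded projection of \<open>F\<close> onto \<open>E\<close> it can be subtracted on all of \<open>F\<close>
  without disturbing the commutation. The projection is chosen before the approximate lift, so a
  sufficiently small initial error makes the correction as small as desired.

  Two more points remain. The seminorms on \<open>Y\<close> may vanish on nonzero vectors, so at each level
  one passes to the quotient by the kernel, realised as a normed space inside the universal
  vector space (\<open>finite_dim_seminorm_quotient\<close>). And the map \<open>F n\<close> to be lifted is only
  almost isometric, hence need not be non-expansive for \<open>p (n + 1)\<close>; it is non-expansive for the
  slightly larger seminorm \<open>max (p (n + 1) y) \<parallel>F n y\<parallel>\<close>, which agrees with \<open>p (n + 1)\<close> on \<open>X\<close>
  (\<open>universal_operator_lifting_step\<close>). The distortion grows a little with each step but stays below
  \<open>1 + \<epsilon>\<close> if the steps are chosen small enough. The chain starts with the extension property of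
  the Gurarii space at level zero.
\<close>

section \<open>Linear maps and seminorms on subspaces\<close>

lemma linear_on_diff:
  assumes "subspace V" "linear_on V f" "x \<in> V" "y \<in> V"
  shows "f (x - y) = f x - f y"
proof -
  have "f (x + (-1) *\<^sub>R y) = f x + (-1) *\<^sub>R f y"
    using assms unfolding linear_on_def by (metis subspace_scale)
  then show ?thesis by simp
qed

lemma linear_on_UNIV_eq_linear: "linear_on UNIV f \<longleftrightarrow> linear f"
  by (auto simp: linear_on_def linear_iff)

lemma seminorm_on_triangle: "seminorm_on V s \<Longrightarrow> x \<in> V \<Longrightarrow> y \<in> V \<Longrightarrow> s (x + y) \<le> s x + s y"
  by (simp add: seminorm_on_def)

lemma seminorm_on_scale: "seminorm_on V s \<Longrightarrow> x \<in> V \<Longrightarrow> s (c *\<^sub>R x) = \<bar>c\<bar> * s x"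
  by (simp add: seminorm_on_def)

lemma seminorm_on_0: "subspace V \<Longrightarrow> seminorm_on V s \<Longrightarrow> s 0 = 0"
  using seminorm_on_scale[of V s 0 0] by (simp add: subspace_0)

lemma seminorm_on_minus: "seminorm_on V s \<Longrightarrow> x \<in> V \<Longrightarrow> s (- x) = s x"
  using seminorm_on_scale[of V s x "-1"] by simp

lemma seminorm_on_abs_diff:
  assumes "subspace V" "seminorm_on V s" "x \<in> V" "y \<in> V"
  shows "\<bar>s x - s y\<bar> \<le> s (x - y)"
proof -
  have "s ((x - y) + y) \<le> s (x - y) + s y" "s ((y - x) + x) \<le> s (y - x) + s x"
    using assms unfolding seminorm_on_def by (meson subspace_diff)+
  moreover have "s (y - x) = s (x - y)"
    using seminorm_on_minus[OF assms(2) subspace_diff[OF assms(1,3,4)]] by simp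
  ultimately show ?thesis by simp
qed

lemma seminorm_on_sum:
  assumes "subspace V" "seminorm_on V s" "\<And>b. b \<in> B \<Longrightarrow> v b \<in> V"
  shows "s (\<Sum>b\<in>B. u b *\<^sub>R v b) \<le> (\<Sum>b\<in>B. \<bar>u b\<bar> * s (v b))"
proof (cases "finite B")
  case True
  then show ?thesis using assms(3)
  proof (induction B)
    case empty
    then show ?case using seminorm_on_0[OF assms(1,2)] by simp
  next
    case (insert b B)
    have "u b *\<^sub>R v b \<in> V" "(\<Sum>b\<in>B. u b *\<^sub>R v b) \<in> V"
      using insert.prems assms(1) by (auto intro!: subspace_sum subspace_scale)
    then have "s (u b *\<^sub>R v b + (\<Sum>b\<in>B. u b *\<^sub>R v b)) \<le> s (u b *\<^sub>R v b) + s (\<Sum>b\<in>B. u b *\<^sub>R v b)"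
      using assms(2) unfolding seminorm_on_def by blast
    moreover have "s (u b *\<^sub>R v b) = \<bar>u b\<bar> * s (v b)"
      using insert.prems assms(2) unfolding seminorm_on_def by blast
    ultimately show ?case using insert by simp
  qed
qed (use seminorm_on_0[OF assms(1,2)] in simp)

section \<open>Finite-dimensional normed spaces\<close>

lemma finite_dim_subspace: "finite_dim V \<Longrightarrow> subspace V"
  unfolding finite_dim_def by (metis subspace_span)

lemma finite_dim_adapted_basis:
  assumes "finite_dim Y" "subspace K" "K \<subseteq> Y"
  obtains A B where "A \<subseteq> B" "finite B" "independent B" "span A = K" "span B = Y"
proof -
  obtain A where A: "A \<subseteq> K" "independent A" "K \<subseteq> span A"
    using maximal_independent_subset by blast
  obtain B where B: "A \<subseteq> B" "B \<subseteq> Y" "independent B" "Y \<subseteq> span B"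
    using maximal_independent_subset_extend[of A Y] A assms(3) by blast
  have "finite B"
    using assms(1) B(2,3) independent_span_bound unfolding finite_dim_def by blast
  moreover have "span A = K" using A assms(2) by (simp add: span_minimal subset_antisym)
  moreover have "span B = Y"
    using B finite_dim_subspace[OF assms(1)] by (simp add: span_minimal subset_antisym)
  ultimately show thesis using that B by blast
qed

lemma span_finite_coordinates:
  assumes "finite B" "x \<in> span B"
  obtains u where "x = (\<Sum>b\<in>B. u b *\<^sub>R b)"
  using assms(2) unfolding span_finite[OF assms(1)] by (elim rangeE)

text \<open>
  This is the equivalence of an arbitrary norm with the \<open>\<ell>\<^sup>1\<close> norm of the coordinates: on the
  compact unit sphere of the latter the norm is continuous and, by independence of the basis,
  nowhere zero, so it is bounded below there; the general case follows by scaling.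
\<close>

lemma norm_on_dominates_coordinates:
  fixes B :: "'v::real_vector set"
  assumes "finite B" "independent B" and N: "normed_space_on (span B) N"
  obtains c where "0 < c" "\<And>u. c * (\<Sum>b\<in>B. \<bar>u b\<bar>) \<le> N (\<Sum>b\<in>B. u b *\<^sub>R b)"
proof (cases "B = {}")
  case True
  have "N 0 = 0" using N unfolding normed_space_on_def by (meson seminorm_on_0)
  then show thesis using that[of 1] True by simp
next
  case False
  let ?S = "span B"
  have S: "subspace ?S" and sn: "seminorm_on ?S N" using N by (auto simp: normed_space_on_def)
  define v where "v u = (\<Sum>b\<in>B. u b *\<^sub>R b)" for u :: "'v \<Rightarrow> real"
  have vS: "v u \<in> ?S" for u unfolding v_def by (intro span_sum span_scale span_base)
  \<comment> \<open>Forcing the coordinates outside \<open>B\<close> to be zero makes \<open>C\<close> a product of compact sets over the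
    whole type, so Tychonoff's theorem applies to it in the topology of pointwise convergence.\<close>
  define C where "C = (\<Pi>\<^sub>E b\<in>UNIV. if b \<in> B then {-1..1::real} else {0})"
  define K where "K = C \<inter> {u. (\<Sum>b\<in>B. \<bar>u b\<bar>) = 1}"
  have coord: "continuous_on UNIV (\<lambda>u::'v \<Rightarrow> real. \<bar>u b\<bar>)" for b
    by (intro continuous_intros continuous_on_product_coordinates)
  have "compactin (product_topology (\<lambda>_::'v. euclidean) UNIV) C"
    unfolding C_def compactin_PiE by auto
  then have "compact C" by (simp add: euclidean_product_topology)
  moreover have "closed {u::'v \<Rightarrow> real. (\<Sum>b\<in>B. \<bar>u b\<bar>) = 1}"
    by (intro closed_Collect_eq continuous_intros coord)
  ultimately have K: "compact K" unfolding K_def by blast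
  have vdiff: "v u - v w = (\<Sum>b\<in>B. (u b - w b) *\<^sub>R b)" for u w
    by (simp add: v_def scaleR_diff_left sum_subtractf)
  have bound: "\<bar>N (v u) - N (v w)\<bar> \<le> (\<Sum>b\<in>B. \<bar>u b - w b\<bar> * N b)" for u w
  proof -
    have "\<bar>N (v u) - N (v w)\<bar> \<le> N (v u - v w)" by (rule seminorm_on_abs_diff[OF S sn vS vS])
    also have "\<dots> \<le> (\<Sum>b\<in>B. \<bar>u b - w b\<bar> * N b)"
      unfolding vdiff by (rule seminorm_on_sum[OF S sn]) (simp add: span_base)
    finally show ?thesis .
  qed
  have "continuous_on UNIV (\<lambda>u. N (v u))"
    unfolding continuous_on_def
  proof
    fix w :: "'v \<Rightarrow> real"
    have t: "((\<lambda>u::'v \<Rightarrow> real. u b) \<longlongrightarrow> w b) (at w)" for b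
      using continuous_on_product_coordinates[of b] unfolding continuous_on_def by blast
    have "((\<lambda>u. \<Sum>b\<in>B. \<bar>u b - w b\<bar> * N b) \<longlongrightarrow> (\<Sum>b\<in>B. \<bar>w b - w b\<bar> * N b)) (at w)"
      by (intro tendsto_intros t)
    then have lim: "((\<lambda>u. \<Sum>b\<in>B. \<bar>u b - w b\<bar> * N b) \<longlongrightarrow> 0) (at w)" by simp
    have "((\<lambda>u. N (v u) - N (v w)) \<longlongrightarrow> 0) (at w)"
      by (rule Lim_null_comparison[OF _ lim]) (simp add: bound)
    then show "((\<lambda>u. N (v u)) \<longlongrightarrow> N (v w)) (at w)" by (rule LIM_zero_cancel)
  qed
  then have cont: "continuous_on K (\<lambda>u. N (v u))" by (rule continuous_on_subset) simp
  obtain b0 where b0: "b0 \<in> B" using False by blast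
  have "(\<lambda>b. if b = b0 then 1 else 0) \<in> K"
    using b0 \<open>finite B\<close> by (auto simp: K_def C_def if_distrib cong: if_cong)
  then obtain m where m: "m \<in> K" "\<And>u. u \<in> K \<Longrightarrow> N (v m) \<le> N (v u)"
    using continuous_attains_inf[OF K _ cont] by blast
  have "v m \<noteq> 0"
  proof
    assume "v m = 0"
    then have "\<forall>b\<in>B. m b = 0"
      using assms(2) unfolding v_def dependent_finite[OF assms(1)] by blast
    then show False using m(1) by (simp add: K_def)
  qed
  then have pos: "0 < N (v m)"
    using N vS[of m] unfolding normed_space_on_def seminorm_on_def by (force simp: order_less_le)
  have "N (v m) * (\<Sum>b\<in>B. \<bar>u b\<bar>) \<le> N (v u)" for u
  proof -
    define s where "s = (\<Sum>b\<in>B. \<bar>u b\<bar>)"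
    have s0: "0 \<le> s" by (simp add: s_def sum_nonneg)
    show ?thesis
    proof (cases "s = 0")
      case True
      then show ?thesis using vS sn by (simp add: s_def seminorm_on_def)
    next
      case False
      then have sp: "0 < s" using s0 by simp
      define w where "w b = (if b \<in> B then u b / s else 0)" for b
      have le: "\<bar>u b\<bar> \<le> s" if "b \<in> B" for b
        unfolding s_def using \<open>finite B\<close> that member_le_sum[of b B "\<lambda>b. \<bar>u b\<bar>"] by simp
      have "(\<Sum>b\<in>B. \<bar>w b\<bar>) = 1"
        using sp by (simp add: w_def abs_divide sum_divide_distrib[symmetric]) (simp add: s_def)
      moreover have "w \<in> C"
        using le sp by (force simp: C_def w_def abs_le_iff field_simps)
      ultimately have "w \<in> K" by (simp add: K_def)
      have "v u = s *\<^sub>R v w" using sp by (simp add: v_def w_def scaleR_sum_right)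
      then have "N (v u) = s * N (v w)" using sn vS sp by (simp add: seminorm_on_def)
      then show ?thesis using m(2)[OF \<open>w \<in> K\<close>] sp by (simp add: s_def mult.commute)
    qed
  qed
  then show thesis using that pos by (simp add: v_def)
qed

text \<open>
  A basis of \<open>E\<close> extended to one of \<open>F\<close> gives the projection; it is bounded because the norm
  controls all coordinates.
\<close>

lemma finite_dim_bounded_projection:
  fixes E F :: "'v::real_vector set"
  assumes "finite_dim F" and N: "normed_space_on F N" and "subspace E" "E \<subseteq> F"
  obtains P C where "linear P" "P ` F \<subseteq> E" "\<And>x. x \<in> E \<Longrightarrow> P x = x"
    "0 \<le> C" "\<And>x. x \<in> F \<Longrightarrow> N (P x) \<le> C * N x"
proof -
  obtain A B where AB: "A \<subseteq> B" "finite B" "independent B" "span A = E" "span B = F"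
    using finite_dim_adapted_basis[OF assms(1,3,4)] by metis
  obtain P where P: "linear P" "\<forall>b\<in>B. P b = (if b \<in> A then b else 0)"
    using linear_independent_extend[OF AB(3), of "\<lambda>b. if b \<in> A then b else 0"] by blast
  obtain c where c: "0 < c" "\<And>u. c * (\<Sum>b\<in>B. \<bar>u b\<bar>) \<le> N (\<Sum>b\<in>B. u b *\<^sub>R b)"
    using norm_on_dominates_coordinates[OF AB(2,3) N[folded AB(5)]] by metis
  have F: "subspace F" and sn: "seminorm_on F N" using N by (auto simp: normed_space_on_def)
  have PB: "P b \<in> E" if "b \<in> B" for b
    using that P(2) AB(4) by (auto simp: span_base span_zero)
  have PE: "P ` F \<subseteq> E"
    using linear_span_image[OF P(1), of B] span_minimal[of "P ` B" E] PB AB(5) assms(3) by auto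
  have Pid: "P x = x" if "x \<in> E" for x
  proof -
    have "\<And>b. b \<in> A \<Longrightarrow> P b = id b" using P(2) AB(1) by auto
    then have "P x = id x"
      using linear_eq_on_span[OF P(1) linear_id] that unfolding AB(4)[symmetric] by blast
    then show ?thesis by simp
  qed
  define M where "M = Max (insert 0 ((\<lambda>b. N (P b)) ` B))"
  have M: "0 \<le> M" "\<And>b. b \<in> B \<Longrightarrow> N (P b) \<le> M" using AB(2) by (auto simp: M_def)
  have "N (P x) \<le> (M / c) * N x" if xF: "x \<in> F" for x
  proof -
    obtain u where x: "x = (\<Sum>b\<in>B. u b *\<^sub>R b)" 
      using span_finite_coordinates[OF AB(2) xF[folded AB(5)]] by metis
    have "N (P x) = N (\<Sum>b\<in>B. u b *\<^sub>R P b)"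
      by (simp add: x linear_sum[OF P(1)] linear_scale[OF P(1)])
    also have "\<dots> \<le> (\<Sum>b\<in>B. \<bar>u b\<bar> * N (P b))"
      by (rule seminorm_on_sum[OF F sn]) (use PB assms(4) in auto)
    also have "\<dots> \<le> (\<Sum>b\<in>B. \<bar>u b\<bar> * M)" by (intro sum_mono mult_left_mono M) auto
    also have "\<dots> = (M / c) * (c * (\<Sum>b\<in>B. \<bar>u b\<bar>))"
      using c(1) by (simp add: sum_distrib_left mult.commute)
    also have "\<dots> \<le> (M / c) * N x"
      unfolding x using c M(1) by (intro mult_left_mono) auto
    finally show ?thesis .
  qed
  moreover have "0 \<le> M / c" using c M by simp
  ultimately show thesis using that[OF P(1) PE Pid] by blast
qed

section \<open>Normed quotients of finite-dimensional seminormed spaces\<close>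

lemma lookup_scaleR: "Poly_Mapping.lookup (r *\<^sub>R x) i = r *\<^sub>R Poly_Mapping.lookup x i"
proof -
  have "finite {i. r *\<^sub>R Poly_Mapping.lookup x i \<noteq> 0}"
    by (rule finite_subset[of _ "Poly_Mapping.keys x"]) (auto simp: in_keys_iff)
  then show ?thesis by (simp add: scaleR_poly_mapping_def)
qed

text \<open>
  The extension properties of the Gurarii space and of the universal operator speak about normed
  subspaces of one particular vector space. A single linear map into that space serves both to move \<open>Y\<close> there and to divide out
  the vectors of seminorm zero.
\<close>

lemma finite_dim_seminorm_quotient:
  fixes Y :: "'v::real_vector set"
  assumes "finite_dim Y" and sn: "seminorm_on Y N"
  obtains h :: "'v \<Rightarrow> univ_vs" and M
  where "linear h" "finite_dim (h ` Y)" "normed_space_on (h ` Y) M"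
    "\<And>y. y \<in> Y \<Longrightarrow> M (h y) = N y"
proof -
  have Y: "subspace Y" by (rule finite_dim_subspace[OF assms(1)])
  define K where "K = {y \<in> Y. N y = 0}"
  have "subspace K"
  proof (rule subspaceI)
    show "0 \<in> K" using Y sn by (simp add: K_def subspace_0 seminorm_on_0)
    show "x + y \<in> K" if "x \<in> K" "y \<in> K" for x y
    proof -
      have xy: "x \<in> Y" "y \<in> Y" "N x = 0" "N y = 0" using that by (auto simp: K_def)
      then have "x + y \<in> Y" using Y by (simp add: subspace_add)
      moreover have "N (x + y) \<le> N x + N y" using sn xy unfolding seminorm_on_def by blast
      ultimately show ?thesis using sn xy by (simp add: K_def seminorm_on_def order_antisym)
    qed
    show "c *\<^sub>R x \<in> K" if "x \<in> K" for c x
      using that sn Y by (auto simp: K_def seminorm_on_def subspace_scale)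
  qed
  then obtain A B where AB: "A \<subseteq> B" "finite B" "independent B" "span A = K" "span B = Y"
    using finite_dim_adapted_basis[OF assms(1), of K] unfolding K_def by (metis (no_types, lifting) mem_Collect_eq subsetI)
  obtain i :: "'v \<Rightarrow> nat" where i: "inj_on i B"
    using finite_imp_inj_to_nat_seg[OF AB(2)] by blast
  obtain h :: "'v \<Rightarrow> univ_vs" where h: "linear h"
    "\<forall>b\<in>B. h b = (if b \<in> A then 0 else Poly_Mapping.single (real (i b)) 1)"
    using linear_independent_extend[OF AB(3),
        of "\<lambda>b. if b \<in> A then 0 else Poly_Mapping.single (real (i b)) 1"] by blast
  have kernel: "y \<in> K" if yY: "y \<in> Y" and "h y = 0" for y
  proof -
    obtain u where y: "y = (\<Sum>b\<in>B. u b *\<^sub>R b)" 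
      using span_finite_coordinates[OF AB(2) yY[folded AB(5)]] by metis
    have "u d = 0" if d: "d \<in> B" "d \<notin> A" for d
    proof -
      have "0 = Poly_Mapping.lookup (h y) (real (i d))" using \<open>h y = 0\<close> by simp
      also have "\<dots> = (\<Sum>b\<in>B. u b * Poly_Mapping.lookup (h b) (real (i d)))"
        by (simp add: y linear_sum[OF h(1)] linear_scale[OF h(1)] lookup_sum lookup_scaleR)
      also have "\<dots> = (\<Sum>b\<in>B. if b = d then u d else 0)"
        using d h(2) i by (intro sum.cong) (auto simp: lookup_single when_def inj_on_eq_iff)
      also have "\<dots> = u d" using d AB(2) by simp
      finally show ?thesis by simp
    qed
    then have "y = (\<Sum>b\<in>A. u b *\<^sub>R b)"
      unfolding y using AB(1,2) by (intro sum.mono_neutral_right) auto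
    moreover have "(\<Sum>b\<in>A. u b *\<^sub>R b) \<in> span A" by (intro span_sum span_scale span_base)
    ultimately show ?thesis using AB(4) by simp
  qed
  have fibre: "N x = N y" if "x \<in> Y" "y \<in> Y" "h x = h y" for x y
  proof -
    have "x - y \<in> K"
      using that by (intro kernel) (auto simp: linear_diff[OF h(1)] subspace_diff[OF Y])
    then show ?thesis using seminorm_on_abs_diff[OF Y sn that(1,2)] by (simp add: K_def)
  qed
  \<comment> \<open>The seminorm is constant on the fibres of \<open>h\<close>, so the chosen preimage is irrelevant.\<close>
  define M where "M z = N (inv_into Y h z)" for z
  have M: "M (h y) = N y" if "y \<in> Y" for y
    unfolding M_def using that by (intro fibre inv_into_into f_inv_into_f) auto
  have "finite_dim (h ` Y)"
    unfolding finite_dim_def using AB(2,5) linear_span_image[OF h(1), of B] by blast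
  moreover have "normed_space_on (h ` Y) M"
    unfolding normed_space_on_def seminorm_on_def
  proof (intro conjI allI ballI impI; (elim imageE)?)
    show "subspace (h ` Y)" using linear_subspace_image[OF h(1) Y] .
  next
    fix x y assume "x \<in> Y"
    then show "0 \<le> M y" if "y = h x" for y
      using that sn M by (simp add: seminorm_on_def)
  next
    fix x y a b assume "x = h a" "a \<in> Y" "y = h b" "b \<in> Y"
    then show "M (x + y) \<le> M x + M y"
      using sn M Y by (simp add: linear_add[OF h(1), symmetric] subspace_add seminorm_on_def)
  next
    fix c x a assume "x = h a" "a \<in> Y"
    then show "M (c *\<^sub>R x) = \<bar>c\<bar> * M x"
      using sn M Y by (simp add: linear_scale[OF h(1), symmetric] subspace_scale seminorm_on_def)
  next
    fix x a assume "M x = 0" "x = h a" "a \<in> Y"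
    then have "a \<in> span A" using M AB(4) by (simp add: K_def)
    moreover have "h b = 0" if "b \<in> A" for b using that h(2) AB(1) by auto
    ultimately show "x = 0"
      using linear_eq_0_on_span[OF h(1), of A a] \<open>x = h a\<close> by blast
  qed
  ultimately show thesis using that[OF h(1)] M by blast
qed

text \<open>
  An operator dominated by the seminorm vanishes wherever the seminorm does, so it descends to
  the quotient.
\<close>

lemma factor_through_seminorm_quotient:
  fixes u :: "'v::real_vector \<Rightarrow> 'g::real_normed_vector" and h :: "'v \<Rightarrow> 'w::real_vector"
  assumes h: "linear h" and V: "subspace V" and M: "M 0 = 0" "\<And>v. v \<in> V \<Longrightarrow> M (h v) = N v"
    and u: "linear_on V u" "\<And>v. v \<in> V \<Longrightarrow> norm (u v) \<le> c * N v"
  obtains u' where "linear_on (h ` V) u'" "\<And>v. v \<in> V \<Longrightarrow> u' (h v) = u v"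
proof -
  define u' where "u' z = u (inv_into V h z)" for z
  have eq: "u' (h v) = u v" if "v \<in> V" for v
  proof -
    define w where "w = inv_into V h (h v)"
    have w: "w \<in> V" "h w = h v"
      using that unfolding w_def by (auto intro: inv_into_into f_inv_into_f)
    have d: "w - v \<in> V" using w that V by (simp add: subspace_diff)
    have "N (w - v) = M (h (w - v))" using M(2)[OF d] by simp
    also have "h (w - v) = 0" using w by (simp add: linear_diff[OF h])
    finally have "u (w - v) = 0" using u(2)[OF d] M(1) by simp
    then show ?thesis
      using linear_on_diff[OF V u(1) w(1) that] by (simp add: u'_def w_def)
  qed
  have "linear_on (h ` V) u'"
    unfolding linear_on_def
  proof (intro conjI allI ballI; elim imageE)
    fix x y a b assume "x = h a" "a \<in> V" "y = h b" "b \<in> V"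
    then show "u' (x + y) = u' x + u' y"
      using u(1) V eq by (simp add: linear_add[OF h, symmetric] subspace_add linear_on_def)
  next
    fix c x a assume "x = h a" "a \<in> V"
    then show "u' (c *\<^sub>R x) = c *\<^sub>R u' x"
      using u(1) V eq by (simp add: linear_scale[OF h, symmetric] subspace_scale linear_on_def)
  qed
  then show thesis using that eq by blast
qed

section \<open>Exact lifting through the universal operator\<close>

text \<open>
  An approximate lift \<open>f\<close> is corrected twice. Subtracting \<open>j \<circ> (\<pi> \<circ> f - T)\<close> makes it commute
  exactly, as \<open>\<pi> \<circ> j\<close> is the identity. The new lift \<open>f1\<close> differs from \<open>e\<close> on \<open>E\<close> by a map into
  the kernel of \<open>\<pi>\<close>, and subtracting this difference after a projection \<open>P\<close> onto \<open>E\<close> makes the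
  values on \<open>E\<close> exact and keeps the commutation.
\<close>

lemma universal_operator_exact_lifting:
  fixes \<pi> j :: "'g::banach \<Rightarrow> 'g" and E F :: "univ_vs set"
  assumes univ: "universal_operator \<pi>" and j: "isometric_embedding UNIV norm j"
    and sec: "\<forall>x. \<pi> (j x) = x" and "0 < \<epsilon>"
    and F: "finite_dim F" "normed_space_on F N" and E: "subspace E" "E \<subseteq> F"
    and T: "nonexpansive_operator F N T" and e: "isometric_embedding E N e"
    and comm: "\<forall>x\<in>E. T x = \<pi> (e x)"
  obtains f where "eps_isometric_embedding \<epsilon> F N f" "\<forall>x\<in>E. f x = e x" "\<forall>x\<in>F. \<pi> (f x) = T x"
proof -
  have lin_\<pi>: "linear \<pi>" and lin_j: "linear j" and norm_j: "\<And>x. norm (j x) = norm x"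
    using univ j by (auto simp: universal_operator_def nonexpansive_operator_def
        isometric_embedding_def linear_on_UNIV_eq_linear)
  have lin_T: "linear_on F T" and lin_e: "linear_on E e"
    using T e by (auto simp: nonexpansive_operator_def isometric_embedding_def)
  have subF: "subspace F" and sn: "seminorm_on F N" using F(2) by (auto simp: normed_space_on_def)
  obtain P C where P: "linear P" "P ` F \<subseteq> E" "\<And>x. x \<in> E \<Longrightarrow> P x = x"
    and C: "0 \<le> C" "\<And>x. x \<in> F \<Longrightarrow> N (P x) \<le> C * N x"
    using finite_dim_bounded_projection[OF F E] by metis
  have PE: "P x \<in> E" "P x \<in> F" if "x \<in> F" for x using that P(2) E(2) by auto
  \<comment> \<open>The corrections have size \<open>\<delta> * (1 + 2 * C)\<close>, and the approximate lift itself is off by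
    \<open>\<delta>\<close>. The total is to be \<open>\<epsilon> / (1 + \<epsilon>)\<close>, as \<open>1 - \<epsilon> / (1 + \<epsilon>) = inverse (1 + \<epsilon>)\<close> is the lower
    bound required of the result.\<close>
  define \<delta> where "\<delta> = (\<epsilon> / (1 + \<epsilon>)) / (2 + 2 * C)"
  have \<delta>: "0 < \<delta>" using \<open>0 < \<epsilon>\<close> C(1) by (simp add: \<delta>_def)
  have \<delta>_eq: "\<delta> * (2 + 2 * C) = \<epsilon> / (1 + \<epsilon>)" using C(1) by (simp add: \<delta>_def)
  have "\<exists>f. eps_isometric_embedding \<delta> F N f \<and> opnorm_le E N (\<lambda>x. f x - e x) \<delta> \<and>
      opnorm_le F N (\<lambda>x. \<pi> (f x) - T x) \<delta>"
    using univ \<delta> F E T e comm unfolding universal_operator_def by blast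
  then obtain f where f: "eps_isometric_embedding \<delta> F N f"
    and fe: "\<And>x. x \<in> E \<Longrightarrow> norm (f x - e x) \<le> \<delta> * N x"
    and fT: "\<And>x. x \<in> F \<Longrightarrow> norm (\<pi> (f x) - T x) \<le> \<delta> * N x"
    by (auto simp: opnorm_le_def)
  have lin_f: "linear_on F f"
    and fN: "\<And>x. x \<in> F \<Longrightarrow> inverse (1 + \<delta>) * N x \<le> norm (f x) \<and> norm (f x) \<le> (1 + \<delta>) * N x"
    using f by (auto simp: eps_isometric_embedding_def)
  define f1 where "f1 x = f x - j (\<pi> (f x) - T x)" for x
  have \<pi>f1: "\<pi> (f1 x) = T x" for x
    by (simp add: f1_def linear_diff[OF lin_\<pi>] sec)
  have f1f: "norm (f1 x - f x) \<le> \<delta> * N x" if "x \<in> F" for x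
    using fT[OF that] by (simp add: f1_def norm_j)
  have lin_f1: "linear_on F f1"
    using lin_f lin_T by (simp add: linear_on_def f1_def linear_add[OF lin_\<pi>] linear_scale[OF lin_\<pi>]
        linear_diff[OF lin_j] linear_add[OF lin_j] linear_scale[OF lin_j] algebra_simps)
  define f2 where "f2 x = f1 x - (f1 (P x) - e (P x))" for x
  have lin_f2: "linear_on F f2"
    using lin_f1 lin_e PE by (simp add: linear_on_def f2_def linear_add[OF P(1)] linear_scale[OF P(1)]
        algebra_simps)
  have f2e: "f2 x = e x" if "x \<in> E" for x using that P(3) by (simp add: f2_def)
  have \<pi>f2: "\<pi> (f2 x) = T x" if "x \<in> F" for x
    using comm PE[OF that] by (simp add: f2_def linear_diff[OF lin_\<pi>] \<pi>f1)
  have f2f: "norm (f2 x - f x) \<le> \<delta> * (1 + 2 * C) * N x" if x: "x \<in> F" for x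
  proof -
    have "f2 x - f x = (f1 x - f x) - ((f1 (P x) - f (P x)) + (f (P x) - e (P x)))"
      by (simp add: f2_def)
    then have "norm (f2 x - f x) \<le> norm (f1 x - f x) + (norm (f1 (P x) - f (P x)) + norm (f (P x) - e (P x)))"
      by (metis norm_triangle_ineq norm_triangle_ineq4 add_left_mono order_trans)
    also have "\<dots> \<le> \<delta> * N x + (\<delta> * N (P x) + \<delta> * N (P x))"
      by (intro add_mono f1f fe x PE[OF x])
    also have "\<dots> \<le> \<delta> * N x + (\<delta> * (C * N x) + \<delta> * (C * N x))"
      using \<delta> C(2)[OF x] by (intro add_mono mult_left_mono) auto
    finally show ?thesis by (simp add: algebra_simps)
  qed
  have "eps_isometric_embedding \<epsilon> F N f2"
    unfolding eps_isometric_embedding_def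
  proof (intro conjI ballI lin_f2)
    fix x assume x: "x \<in> F"
    have N0: "0 \<le> N x" using sn x by (simp add: seminorm_on_def)
    have split: "\<delta> + \<delta> * (1 + 2 * C) = \<epsilon> / (1 + \<epsilon>)"
      using \<delta>_eq by (simp add: algebra_simps)
    have eps: "\<epsilon> / (1 + \<epsilon>) \<le> \<epsilon>" "1 - \<epsilon> / (1 + \<epsilon>) = inverse (1 + \<epsilon>)"
      using \<open>0 < \<epsilon>\<close> by (simp_all add: field_simps)
    have "norm (f2 x) \<le> norm (f x) + norm (f2 x - f x)"
      by (rule norm_triangle_sub)
    also have "\<dots> \<le> (1 + \<delta>) * N x + \<delta> * (1 + 2 * C) * N x"
      using fN[OF x] f2f[OF x] by linarith
    also have "\<dots> = (1 + \<epsilon> / (1 + \<epsilon>)) * N x"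
      unfolding split[symmetric] by (simp add: algebra_simps)
    also have "\<dots> \<le> (1 + \<epsilon>) * N x" using eps(1) N0 by (intro mult_right_mono) auto
    finally show "norm (f2 x) \<le> (1 + \<epsilon>) * N x" .
    have "1 - \<delta> \<le> inverse (1 + \<delta>)"
      using \<delta> by (simp add: field_simps)
    then have "(1 - \<delta>) * N x \<le> inverse (1 + \<delta>) * N x" using N0 by (rule mult_right_mono)
    moreover have "inverse (1 + \<epsilon>) * N x = (1 - \<delta>) * N x - \<delta> * (1 + 2 * C) * N x"
      unfolding eps(2)[symmetric] split[symmetric] by (simp add: algebra_simps)
    moreover have "norm (f x) \<le> norm (f2 x) + norm (f2 x - f x)"
      by (metis norm_minus_commute norm_triangle_sub)
    ultimately show "inverse (1 + \<epsilon>) * N x \<le> norm (f2 x)"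
      using fN[OF x] f2f[OF x] by linarith
  qed
  then show thesis using that f2e \<pi>f2 by blast
qed

lemma eps_isometric_embedding_comp:
  assumes h: "linear h" and f: "eps_isometric_embedding \<epsilon> (h ` Y) M f"
    and M: "\<And>y. y \<in> Y \<Longrightarrow> M (h y) = N y"
  shows "eps_isometric_embedding \<epsilon> Y N (\<lambda>y. f (h y))"
  using f unfolding eps_isometric_embedding_def linear_on_def
  by (auto simp: linear_add[OF h] linear_scale[OF h] M[symmetric])

lemma gurarii_seminorm_extension:
  fixes g :: "'v::real_vector \<Rightarrow> 'g::banach"
  assumes gur: "gurarii_space TYPE('g)" and "0 < \<epsilon>"
    and Y: "finite_dim Y" "seminorm_on Y N" and X: "subspace X" "X \<subseteq> Y"
    and g: "isometric_embedding X N g"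
  obtains f where "eps_isometric_embedding \<epsilon> Y N f" "\<forall>x\<in>X. f x = g x"
proof -
  obtain h :: "'v \<Rightarrow> univ_vs" and M where h: "linear h" "finite_dim (h ` Y)"
    "normed_space_on (h ` Y) M" and M: "\<And>y. y \<in> Y \<Longrightarrow> M (h y) = N y"
    by (rule finite_dim_seminorm_quotient[OF Y]) blast
  have M0: "M 0 = 0" using h(3) by (auto simp: normed_space_on_def intro: seminorm_on_0)
  have MX: "\<And>x. x \<in> X \<Longrightarrow> M (h x) = N x" using M X(2) by auto
  have lin_g: "linear_on X g" and gN: "\<And>x. x \<in> X \<Longrightarrow> norm (g x) = N x"
    using g by (auto simp: isometric_embedding_def)
  have gle: "\<And>x. x \<in> X \<Longrightarrow> norm (g x) \<le> 1 * N x" using gN by simp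
  obtain g' where g': "linear_on (h ` X) g'" "\<And>x. x \<in> X \<Longrightarrow> g' (h x) = g x"
    by (rule factor_through_seminorm_quotient[OF h(1) X(1) M0 MX lin_g gle]) blast+
  have "isometric_embedding (h ` X) M g'"
    using g' gN MX by (auto simp: isometric_embedding_def)
  moreover have "subspace (h ` X)" "h ` X \<subseteq> h ` Y"
    using linear_subspace_image[OF h(1) X(1)] X(2) by auto
  ultimately obtain f where f: "eps_isometric_embedding \<epsilon> (h ` Y) M f" "\<forall>z\<in>h ` X. f z = g' z"
    using gur \<open>0 < \<epsilon>\<close> h(2,3) unfolding gurarii_space_def by metis
  show thesis
    using that[OF eps_isometric_embedding_comp[OF h(1) f(1) M]] f(2) g'(2) by auto
qed

lemma universal_operator_seminorm_lifting:
  fixes \<pi> j :: "'g::banach \<Rightarrow> 'g" and X Y :: "'v::real_vector set"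
  assumes univ: "universal_operator \<pi>" and j: "isometric_embedding UNIV norm j"
    and sec: "\<forall>x. \<pi> (j x) = x" and "0 < \<epsilon>"
    and Y: "finite_dim Y" "seminorm_on Y N" and X: "subspace X" "X \<subseteq> Y"
    and T: "nonexpansive_operator Y N T" and g: "isometric_embedding X N g"
    and comm: "\<forall>x\<in>X. T x = \<pi> (g x)"
  obtains f where "eps_isometric_embedding \<epsilon> Y N f" "\<forall>x\<in>X. f x = g x" "\<forall>y\<in>Y. \<pi> (f y) = T y"
proof -
  obtain h :: "'v \<Rightarrow> univ_vs" and M where h: "linear h" "finite_dim (h ` Y)"
    "normed_space_on (h ` Y) M" and M: "\<And>y. y \<in> Y \<Longrightarrow> M (h y) = N y"
    by (rule finite_dim_seminorm_quotient[OF Y]) blast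
  have M0: "M 0 = 0" using h(3) by (auto simp: normed_space_on_def intro: seminorm_on_0)
  have MX: "\<And>x. x \<in> X \<Longrightarrow> M (h x) = N x" using M X(2) by auto
  have lin_g: "linear_on X g" and gN: "\<And>x. x \<in> X \<Longrightarrow> norm (g x) = N x"
    using g by (auto simp: isometric_embedding_def)
  have gle: "\<And>x. x \<in> X \<Longrightarrow> norm (g x) \<le> 1 * N x" using gN by simp
  have lin_T: "linear_on Y T" and Tle: "\<And>y. y \<in> Y \<Longrightarrow> norm (T y) \<le> 1 * N y"
    using T by (auto simp: nonexpansive_operator_def opnorm_le_def)
  obtain g' where g': "linear_on (h ` X) g'" "\<And>x. x \<in> X \<Longrightarrow> g' (h x) = g x"
    by (rule factor_through_seminorm_quotient[OF h(1) X(1) M0 MX lin_g gle]) blast+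
  obtain T' where T': "linear_on (h ` Y) T'" "\<And>y. y \<in> Y \<Longrightarrow> T' (h y) = T y"
    by (rule factor_through_seminorm_quotient[OF h(1) finite_dim_subspace[OF Y(1)] M0 M lin_T Tle]) blast+
  have "isometric_embedding (h ` X) M g'"
    using g' gN MX by (auto simp: isometric_embedding_def)
  moreover have "nonexpansive_operator (h ` Y) M T'"
    using T' Tle M by (auto simp: nonexpansive_operator_def opnorm_le_def)
  moreover have "subspace (h ` X)" "h ` X \<subseteq> h ` Y"
    using linear_subspace_image[OF h(1) X(1)] X(2) by auto
  moreover have "\<forall>z\<in>h ` X. T' z = \<pi> (g' z)" using T'(2) g'(2) comm X(2) by auto
  ultimately obtain f where f: "eps_isometric_embedding \<epsilon> (h ` Y) M f" "\<forall>z\<in>h ` X. f z = g' z"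
    "\<forall>z\<in>h ` Y. \<pi> (f z) = T' z"
    using universal_operator_exact_lifting[OF univ j sec \<open>0 < \<epsilon>\<close> h(2,3)] by metis
  show thesis
    using that[OF eps_isometric_embedding_comp[OF h(1) f(1) M]] f(2,3) g'(2) T'(2) by auto
qed

text \<open>
  One step up the tower, from the seminorm \<open>s\<close> to the larger \<open>s'\<close>. The map \<open>F\<close> may expand \<open>s'\<close> by
  the factor \<open>1 + d\<close>, so the lifting takes place with respect to \<open>N = max s' \<parallel>F\<parallel>\<close>. This lies
  between \<open>s'\<close> and \<open>(1 + d) s'\<close>, and on \<open>X\<close> it equals \<open>s'\<close>, because there \<open>F = \<pi> \<circ> g\<close> with
  \<open>\<pi>\<close> non-expansive and \<open>g\<close> isometric; thus \<open>g\<close> is still isometric for \<open>N\<close>.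
\<close>

lemma universal_operator_lifting_step:
  fixes \<pi> j :: "'g::banach \<Rightarrow> 'g" and X Y :: "'v::real_vector set"
  assumes univ: "universal_operator \<pi>" and j: "isometric_embedding UNIV norm j"
    and sec: "\<forall>x. \<pi> (j x) = x" and d: "0 < d" "d < d'"
    and Y: "finite_dim Y" and s': "seminorm_on Y s'" and le: "\<forall>y\<in>Y. s y \<le> s' y"
    and X: "subspace X" "X \<subseteq> Y"
    and F: "eps_isometric_embedding d Y s F" and g: "isometric_embedding X s' g"
    and comm: "\<forall>x\<in>X. F x = \<pi> (g x)"
  obtains F' where "eps_isometric_embedding d' Y s' F'" "\<forall>x\<in>X. F' x = g x"
    "\<forall>y\<in>Y. \<pi> (F' y) = F y"
proof -
  have subY: "subspace Y" by (rule finite_dim_subspace[OF Y])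
  have lin_F: "linear_on Y F" and F_le: "\<And>y. y \<in> Y \<Longrightarrow> norm (F y) \<le> (1 + d) * s y"
    using F by (auto simp: eps_isometric_embedding_def)
  define N where "N y = max (s' y) (norm (F y))" for y
  have sN: "seminorm_on Y N"
    unfolding seminorm_on_def
  proof (intro conjI ballI allI)
    fix x y assume xy: "x \<in> Y" "y \<in> Y"
    have "norm (F (x + y)) \<le> norm (F x) + norm (F y)"
      using lin_F xy by (simp add: linear_on_def norm_triangle_ineq)
    then show "N (x + y) \<le> N x + N y"
      using seminorm_on_triangle[OF s' xy] by (simp add: N_def max_def)
  next
    fix c x assume x: "x \<in> Y"
    then have "norm (F (c *\<^sub>R x)) = \<bar>c\<bar> * norm (F x)" using lin_F by (simp add: linear_on_def)
    then show "N (c *\<^sub>R x) = \<bar>c\<bar> * N x"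
      using seminorm_on_scale[OF s' x] by (simp add: N_def max_mult_distrib_left)
  qed (simp add: N_def le_max_iff_disj)
  have F_nonexp: "nonexpansive_operator Y N F"
    using lin_F by (simp add: nonexpansive_operator_def opnorm_le_def N_def)
  have "\<And>z. norm (\<pi> z) \<le> norm z"
    using univ by (simp add: universal_operator_def nonexpansive_operator_def opnorm_le_def)
  then have gN: "isometric_embedding X N g"
    using g comm by (simp add: isometric_embedding_def N_def max_def) (metis order_antisym)
  \<comment> \<open>chosen so that the distortions of \<open>N\<close> and of the lift multiply to \<open>1 + d'\<close>\<close>
  define \<eta> where "\<eta> = (1 + d') / (1 + d) - 1"
  have \<eta>: "0 < \<eta>" "(1 + \<eta>) * (1 + d) = 1 + d'" using d by (auto simp: \<eta>_def field_simps)
  obtain F' where F': "eps_isometric_embedding \<eta> Y N F'" "\<forall>x\<in>X. F' x = g x"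
    "\<forall>y\<in>Y. \<pi> (F' y) = F y"
    using universal_operator_seminorm_lifting[OF univ j sec \<eta>(1) Y sN X F_nonexp gN comm] by metis
  have "eps_isometric_embedding d' Y s' F'"
    unfolding eps_isometric_embedding_def
  proof (intro conjI ballI)
    show "linear_on Y F'" using F'(1) by (simp add: eps_isometric_embedding_def)
  next
    fix y assume y: "y \<in> Y"
    have s0: "0 \<le> s' y" using s' y by (simp add: seminorm_on_def)
    have "norm (F y) \<le> (1 + d) * s' y"
    proof -
      have "(1 + d) * s y \<le> (1 + d) * s' y" using le y d by (intro mult_left_mono) auto
      then show ?thesis using F_le[OF y] by linarith
    qed
    moreover have "s' y \<le> (1 + d) * s' y" using s0 d by (simp add: algebra_simps)
    ultimately have "N y \<le> (1 + d) * s' y" by (simp add: N_def)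
    then have "(1 + \<eta>) * N y \<le> (1 + \<eta>) * ((1 + d) * s' y)" using \<eta>(1) by (intro mult_left_mono) auto
    also have "\<dots> = (1 + d') * s' y" by (simp only: mult.assoc[symmetric] \<eta>(2))
    finally show "norm (F' y) \<le> (1 + d') * s' y"
      using F'(1) y by (force simp: eps_isometric_embedding_def)
    have "1 + \<eta> \<le> 1 + d'" using \<eta> d by (simp add: \<eta>_def field_simps)
    then have "inverse (1 + d') \<le> inverse (1 + \<eta>)" using \<eta>(1) by (intro le_imp_inverse_le) auto
    then have "inverse (1 + d') * s' y \<le> inverse (1 + \<eta>) * N y"
      using s0 \<eta>(1) by (intro mult_mono) (auto simp: N_def)
    then show "inverse (1 + d') * s' y \<le> norm (F' y)"
      using F'(1) y by (force simp: eps_isometric_embedding_def)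
  qed
  then show thesis using that F' by blast
qed

section \<open>The sequence space as an inverse limit\<close>

text \<open>
  The algebra behind the tower: every \<open>z\<close> splits uniquely into \<open>j (\<pi> z)\<close> and a remainder in the
  kernel of \<open>\<pi>\<close>, which \<open>\<kappa>\<close> identifies with the whole space. Iterating this splitting is what
  makes \<open>phi\<close> a linear bijection onto the sequences supported on an initial segment.
\<close>

locale split_operator =
  fixes \<pi> j \<kappa> :: "'g::real_normed_vector \<Rightarrow> 'g"
  assumes linear_\<pi>: "linear \<pi>" and linear_j: "linear j" and \<pi>_j: "\<pi> (j x) = x"
    and linear_\<kappa>: "linear_on {x. \<pi> x = 0} \<kappa>" and bij_\<kappa>: "bij_betw \<kappa> {x. \<pi> x = 0} UNIV"
begin

lemma remainder_in_kernel: "\<pi> (z - j (\<pi> z)) = 0"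
  by (simp add: linear_diff[OF linear_\<pi>] \<pi>_j)

lemma phi_beyond: "n < k \<Longrightarrow> phi \<pi> j \<kappa> n z k = 0"
  by (induction n arbitrary: z) auto

lemma linear_phi: "linear (phi \<pi> j \<kappa> n)"
proof (induction n)
  case 0
  show ?case by (rule linearI) (auto simp: fun_eq_iff scaleR_fun_def)
next
  case (Suc n)
  have add: "\<kappa> ((x + y) - j (\<pi> (x + y))) = \<kappa> (x - j (\<pi> x)) + \<kappa> (y - j (\<pi> y))" for x y
  proof -
    have eq: "(x + y) - j (\<pi> (x + y)) = (x - j (\<pi> x)) + (y - j (\<pi> y))"
      by (simp add: linear_add[OF linear_\<pi>] linear_add[OF linear_j])
    show ?thesis unfolding eq using linear_\<kappa> remainder_in_kernel by (simp add: linear_on_def)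
  qed
  have scale: "\<kappa> (c *\<^sub>R x - j (\<pi> (c *\<^sub>R x))) = c *\<^sub>R \<kappa> (x - j (\<pi> x))" for c x
  proof -
    have eq: "c *\<^sub>R x - j (\<pi> (c *\<^sub>R x)) = c *\<^sub>R (x - j (\<pi> x))"
      by (simp add: linear_scale[OF linear_\<pi>] linear_scale[OF linear_j] scaleR_diff_right)
    show ?thesis unfolding eq using linear_\<kappa> remainder_in_kernel by (simp add: linear_on_def)
  qed
  show ?case
  proof (rule linearI)
    show "phi \<pi> j \<kappa> (Suc n) (x + y) = phi \<pi> j \<kappa> (Suc n) x + phi \<pi> j \<kappa> (Suc n) y" for x y
      by (simp only: phi.simps add) (simp add: fun_eq_iff linear_add[OF linear_\<pi>] linear_add[OF Suc])
    show "phi \<pi> j \<kappa> (Suc n) (c *\<^sub>R x) = c *\<^sub>R phi \<pi> j \<kappa> (Suc n) x" for c x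
      by (simp only: phi.simps scale)
        (simp add: fun_eq_iff linear_scale[OF linear_\<pi>] linear_scale[OF Suc] scaleR_fun_def)
  qed
qed

lemma phi_Suc_eq_iff:
  assumes "x (Suc n) = 0"
  shows "phi \<pi> j \<kappa> (Suc n) z = x(Suc n := a) \<longleftrightarrow>
    phi \<pi> j \<kappa> n (\<pi> z) = x \<and> \<kappa> (z - j (\<pi> z)) = a"
proof -
  have "phi \<pi> j \<kappa> n (\<pi> z) (Suc n) = x (Suc n)" using assms by (simp add: phi_beyond)
  then show ?thesis by (auto simp: fun_eq_iff split: if_splits)
qed

lemma inj_phi: "inj (phi \<pi> j \<kappa> n)"
proof (induction n)
  case 0
  show ?case by (rule injI) (auto dest: fun_cong[of _ _ 0])
next
  case (Suc n)
  show ?case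
  proof (rule injI)
    fix x y assume "phi \<pi> j \<kappa> (Suc n) x = phi \<pi> j \<kappa> (Suc n) y"
    then have "phi \<pi> j \<kappa> n (\<pi> x) = phi \<pi> j \<kappa> n (\<pi> y)"
      and \<kappa>_eq: "\<kappa> (x - j (\<pi> x)) = \<kappa> (y - j (\<pi> y))"
      using phi_Suc_eq_iff[of "phi \<pi> j \<kappa> n (\<pi> y)" n x "\<kappa> (y - j (\<pi> y))"]
      by (simp_all add: phi_beyond)
    then have "\<pi> x = \<pi> y" using Suc by (simp add: inj_eq)
    moreover have "x - j (\<pi> x) = y - j (\<pi> y)"
      using \<kappa>_eq bij_\<kappa> remainder_in_kernel by (auto simp: bij_betw_def dest: inj_onD)
    ultimately show "x = y" by simp
  qed
qed

lemma phi_surj: "(\<And>k. n < k \<Longrightarrow> x k = 0) \<Longrightarrow> \<exists>z. phi \<pi> j \<kappa> n z = x"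
proof (induction n arbitrary: x)
  case 0
  then have "phi \<pi> j \<kappa> 0 (x 0) = x" by (auto simp: fun_eq_iff)
  then show ?case by blast
next
  case (Suc n)
  have "\<And>k. n < k \<Longrightarrow> (x(Suc n := 0)) k = 0"
    using Suc.prems by (metis fun_upd_apply Suc_lessI)
  then obtain z where z: "phi \<pi> j \<kappa> n z = x(Suc n := 0)" using Suc.IH by blast
  obtain w where w: "\<pi> w = 0" "\<kappa> w = x (Suc n)" 
    using bij_betw_imp_surj_on[OF bij_\<kappa>] by (metis (mono_tags, lifting) UNIV_I imageE mem_Collect_eq)
  have "\<pi> (j z + w) = z" by (simp add: linear_add[OF linear_\<pi>] \<pi>_j w)
  then have "phi \<pi> j \<kappa> (Suc n) (j z + w) = x" by (simp add: z w)
  then show ?case by blast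
qed

text \<open>
  The coordinate map of the inverse limit: the truncation of \<open>x\<close> to its first \<open>n + 1\<close> entries,
  carried back to the base space.
\<close>

definition level :: "nat \<Rightarrow> (nat \<Rightarrow> 'g) \<Rightarrow> 'g" where
  "level n x = inv (phi \<pi> j \<kappa> n) (\<lambda>k. if k \<le> n then x k else 0)"

lemma power_seminorm_eq_norm_level: "power_seminorm \<pi> j \<kappa> n x = norm (level n x)"
  by (simp add: power_seminorm_def power_norm_def level_def)

lemma phi_level: "phi \<pi> j \<kappa> n (level n x) = (\<lambda>k. if k \<le> n then x k else 0)"
  unfolding level_def
proof (rule f_inv_into_f)
  obtain z where "phi \<pi> j \<kappa> n z = (\<lambda>k. if k \<le> n then x k else 0)"
    using phi_surj[of n "\<lambda>k. if k \<le> n then x k else 0"] by auto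
  then show "(\<lambda>k. if k \<le> n then x k else 0) \<in> range (phi \<pi> j \<kappa> n)" by (metis rangeI)
qed

lemma level_eqI: "phi \<pi> j \<kappa> n z = (\<lambda>k. if k \<le> n then x k else 0) \<Longrightarrow> level n x = z"
  using inj_phi[of n] phi_level[of n x] by (metis injD)

lemma linear_level: "linear (level n)"
proof (rule linearI)
  show "level n (x + y) = level n x + level n y" for x y
    by (rule level_eqI) (auto simp: linear_add[OF linear_phi] phi_level fun_eq_iff)
  show "level n (c *\<^sub>R x) = c *\<^sub>R level n x" for c x
    by (rule level_eqI) (auto simp: linear_scale[OF linear_phi] phi_level fun_eq_iff scaleR_fun_def)
qed

lemma \<pi>_level: "\<pi> (level (Suc n) x) = level n x"
proof (rule level_eqI[symmetric])
  have "phi \<pi> j \<kappa> (Suc n) (level (Suc n) x) = (\<lambda>k. if k \<le> n then x k else 0)(Suc n := x (Suc n))"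
    unfolding phi_level by (auto simp: fun_eq_iff le_Suc_eq)
  then show "phi \<pi> j \<kappa> n (\<pi> (level (Suc n) x)) = (\<lambda>k. if k \<le> n then x k else 0)"
    by (subst (asm) phi_Suc_eq_iff) auto
qed

lemma eq_if_levels_eq:
  assumes "\<And>n. level n x = level n y"
  shows "x = y"
proof
  fix k
  show "x k = y k" using phi_level[of k x] phi_level[of k y] assms[of k] by (metis order_refl)
qed

text \<open>
  The point of the sequence space with prescribed levels \<open>z\<close>. By the recursion for \<open>phi\<close>, the entry with
  index \<open>Suc m\<close> is the kernel component of \<open>z (Suc m)\<close>; as \<open>\<pi> (z (Suc m)) = z m\<close>, the other
  component is \<open>j (z m)\<close>.
\<close>

definition thread :: "(nat \<Rightarrow> 'g) \<Rightarrow> nat \<Rightarrow> 'g" where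
  "thread z k = (case k of 0 \<Rightarrow> z 0 | Suc m \<Rightarrow> \<kappa> (z (Suc m) - j (z m)))"

lemma level_thread:
  assumes "\<And>n. \<pi> (z (Suc n)) = z n"
  shows "level n (thread z) = z n"
proof (rule level_eqI)
  show "phi \<pi> j \<kappa> n (z n) = (\<lambda>k. if k \<le> n then thread z k else 0)"
  proof (induction n)
    case 0
    show ?case by (auto simp: thread_def)
  next
    case (Suc n)
    then show ?case by (auto simp: fun_eq_iff assms thread_def le_Suc_eq)
  qed
qed

end

section \<open>Almost universal disposition\<close>

text \<open>
  A vector on which all seminorms vanish lies in the same open sets as zero, so the Hausdorff
  property of a metrizable topology forces it to be zero.
\<close>

lemma frechet_space_separated:
  assumes "frechet_space V p" "x \<in> V" "\<And>i. p i x = 0"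
  shows "x = 0"
proof (rule ccontr)
  assume "x \<noteq> 0"
  have V: "subspace V" and sn: "\<And>i. seminorm_on V (p i)"
    and metr: "metrizable_space (seminorm_topology V p)"
    using assms(1) by (auto simp: frechet_space_def)
  let ?B = "{{y \<in> V. p i (y - a) < r} | a i r. a \<in> V \<and> 0 < r}"
  have same: "(0 \<in> U) = (x \<in> U)" if "generate_topology_on ?B U" for U
    using that
  proof induction
    case (Basis U)
    then obtain a i r where U: "U = {y \<in> V. p i (y - a) < r}" and a: "a \<in> V" by blast
    have "\<bar>p i (0 - a) - p i (x - a)\<bar> \<le> p i ((0 - a) - (x - a))"
      using V a assms(2) by (intro seminorm_on_abs_diff[OF V sn]) (simp_all add: subspace_diff subspace_0 subspace_neg)
    also have "(0 - a) - (x - a) = - x" by simp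
    finally have "p i (0 - a) = p i (x - a)"
      using assms(3) seminorm_on_minus[OF sn assms(2)] by simp
    then show ?case using U V assms(2) by (simp add: subspace_0)
  qed auto
  have open_iff: "openin (seminorm_topology V p) U \<longleftrightarrow> generate_topology_on ?B U" for U
    by (simp add: seminorm_topology_def openin_topology_generated_by_iff)
  have top: "y \<in> topspace (seminorm_topology V p)" if y: "y \<in> V" for y
  proof -
    have "{z \<in> V. p 0 (z - y) < 1} \<in> ?B" using y by (intro CollectI exI[of _ y] exI[of _ 0] exI[of _ 1]) simp
    then have "openin (seminorm_topology V p) {z \<in> V. p 0 (z - y) < 1}"
      unfolding open_iff by (rule generate_topology_on.Basis)
    moreover have "y \<in> {z \<in> V. p 0 (z - y) < 1}" using y seminorm_on_0[OF V sn] by simp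
    ultimately show ?thesis using openin_subset by blast
  qed
  have "Hausdorff_space (seminorm_topology V p)" using metr by (rule metrizable_imp_Hausdorff_space)
  then obtain U W where "openin (seminorm_topology V p) U" "0 \<in> U" "x \<in> W" "disjnt U W"
    unfolding Hausdorff_space_def
    using top[OF assms(2)] top[OF subspace_0[OF V]] \<open>x \<noteq> 0\<close> by metis
  then show False using same open_iff by (auto simp: disjnt_iff)
qed

theorem theorem3p3:
  fixes \<pi> j \<kappa> :: "'g::banach \<Rightarrow> 'g"
    and X Y :: "'v::real_vector set"
    and p :: "nat \<Rightarrow> 'v \<Rightarrow> real"
    and f0 :: "'v \<Rightarrow> (nat \<Rightarrow> 'g)"
    and \<epsilon> :: real
  assumes "gurarii_space TYPE('g)"
    and "universal_operator \<pi>"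
    and "isometric_embedding UNIV norm j"
    and "\<forall>x. \<pi> (j x) = x"
    and "isometric_embedding {x. \<pi> x = 0} norm \<kappa>"
    and "\<kappa> ` {x. \<pi> x = 0} = UNIV"
    and "0 < \<epsilon>"
    and "finite_dim Y" and "frechet_space Y p" and "graded Y p"
    and "finite_dim X" and "frechet_space X p" and "graded X p" and "X \<subseteq> Y"
    and "frechet_isometric_embedding X p (power_seminorm \<pi> j \<kappa>) f0"
  shows "\<exists>f. frechet_eps_isometric_embedding \<epsilon> Y p (power_seminorm \<pi> j \<kappa>) f \<and> (\<forall>x\<in>X. f x = f0 x)"
proof -
  have lin_\<pi>: "linear \<pi>" and lin_j: "linear j"
    using assms(2,3) by (auto simp: universal_operator_def nonexpansive_operator_def
        isometric_embedding_def linear_on_UNIV_eq_linear)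
  have lin_\<kappa>: "linear_on {x. \<pi> x = 0} \<kappa>" and norm_\<kappa>: "\<And>x. \<pi> x = 0 \<Longrightarrow> norm (\<kappa> x) = norm x"
    using assms(5) by (auto simp: isometric_embedding_def)
  have ker: "subspace {x. \<pi> x = 0}" by (rule linear_subspace_kernel[OF lin_\<pi>])
  have "inj_on \<kappa> {x. \<pi> x = 0}"
  proof (rule inj_onI)
    fix x y assume xy: "x \<in> {x. \<pi> x = 0}" "y \<in> {x. \<pi> x = 0}" "\<kappa> x = \<kappa> y"
    then have "norm (x - y) = norm (\<kappa> x - \<kappa> y)"
      using norm_\<kappa>[of "x - y"] linear_on_diff[OF ker lin_\<kappa>] by (simp add: linear_diff[OF lin_\<pi>])
    then show "x = y" using xy by simp
  qed
  then interpret split_operator \<pi> j \<kappa>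
    using lin_\<pi> lin_j lin_\<kappa> assms(4,6) by (intro split_operator.intro) (auto simp: bij_betw_def)
  have subX: "subspace X" and subY: "subspace Y" and sn: "\<And>i. seminorm_on Y (p i)"
    using assms(9,12) by (auto simp: frechet_space_def)
  have lin_f0: "linear_on X f0" and f0p: "\<And>i x. x \<in> X \<Longrightarrow> norm (level i (f0 x)) = p i x"
    using assms(15) by (auto simp: frechet_isometric_embedding_def power_seminorm_eq_norm_level)
  have g: "isometric_embedding X (p n) (\<lambda>x. level n (f0 x))" for n
    using lin_f0 f0p by (simp add: isometric_embedding_def linear_on_def
        linear_add[OF linear_level] linear_scale[OF linear_level])
  \<comment> \<open>The distortion allowed at level \<open>n\<close>: strictly increasing, to leave room for each lifting, and
    below \<open>\<epsilon>\<close> throughout.\<close>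
  define d where "d n = \<epsilon> * (real n + 1) / (real n + 2)" for n
  have d_pos: "0 < d n" for n
    unfolding d_def using \<open>0 < \<epsilon>\<close> by (intro divide_pos_pos mult_pos_pos) auto
  have d_less: "d n < d (Suc n)" and d_le: "d n \<le> \<epsilon>" for n
    using \<open>0 < \<epsilon>\<close> by (simp_all add: d_def field_simps)
  have "\<exists>F. \<forall>n. (eps_isometric_embedding (d n) Y (p n) (F n) \<and> (\<forall>x\<in>X. F n x = level n (f0 x))) \<and>
      (\<forall>y\<in>Y. \<pi> (F (Suc n) y) = F n y)"
  proof (rule dependent_nat_choice)
    show "\<exists>F. eps_isometric_embedding (d 0) Y (p 0) F \<and> (\<forall>x\<in>X. F x = level 0 (f0 x))"
      using gurarii_seminorm_extension[OF assms(1) d_pos assms(8) sn subX assms(14) g] by metis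
  next
    fix F n assume F: "eps_isometric_embedding (d n) Y (p n) F \<and> (\<forall>x\<in>X. F x = level n (f0 x))"
    have le: "\<forall>y\<in>Y. p n y \<le> p (Suc n) y" using assms(10) by (simp add: graded_def)
    have comm: "\<forall>x\<in>X. F x = \<pi> (level (Suc n) (f0 x))" using F by (simp add: \<pi>_level)
    show "\<exists>F'. (eps_isometric_embedding (d (Suc n)) Y (p (Suc n)) F' \<and>
        (\<forall>x\<in>X. F' x = level (Suc n) (f0 x))) \<and> (\<forall>y\<in>Y. \<pi> (F' y) = F y)"
      using universal_operator_lifting_step[OF assms(2,3,4) d_pos d_less assms(8) sn le subX
          assms(14) conjunct1[OF F] g comm] by metis
  qed
  then obtain F where F: "\<And>n. eps_isometric_embedding (d n) Y (p n) (F n)"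
    and FX: "\<And>n x. x \<in> X \<Longrightarrow> F n x = level n (f0 x)"
    and F\<pi>: "\<And>n y. y \<in> Y \<Longrightarrow> \<pi> (F (Suc n) y) = F n y"
    by blast
  define f where "f y = thread (\<lambda>n. F n y)" for y
  have level_f: "level n (f y) = F n y" if "y \<in> Y" for n y
    unfolding f_def by (rule level_thread) (rule F\<pi>[OF that])
  have lin_F: "linear_on Y (F n)" for n using F by (simp add: eps_isometric_embedding_def)
  have "linear_on Y f"
    unfolding linear_on_def
  proof (intro conjI ballI allI)
    show "f (x + y) = f x + f y" if "x \<in> Y" "y \<in> Y" for x y
      using that lin_F subY by (intro eq_if_levels_eq)
        (simp add: linear_add[OF linear_level] level_f subspace_add linear_on_def)
    show "f (c *\<^sub>R x) = c *\<^sub>R f x" if "x \<in> Y" for c x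
      using that lin_F subY by (intro eq_if_levels_eq)
        (simp add: linear_scale[OF linear_level] level_f subspace_scale linear_on_def)
  qed
  moreover have bounds: "inverse (1 + \<epsilon>) * p n y \<le> norm (F n y) \<and> norm (F n y) \<le> (1 + \<epsilon>) * p n y"
    if y: "y \<in> Y" for n y
  proof -
    have p0: "0 \<le> p n y" using sn y by (simp add: seminorm_on_def)
    have "inverse (1 + \<epsilon>) * p n y \<le> inverse (1 + d n) * p n y"
      using d_pos[of n] d_le[of n] p0 by (intro mult_right_mono le_imp_inverse_le) auto
    moreover have "(1 + d n) * p n y \<le> (1 + \<epsilon>) * p n y"
      using d_le[of n] p0 by (intro mult_right_mono) auto
    moreover have "inverse (1 + d n) * p n y \<le> norm (F n y)" "norm (F n y) \<le> (1 + d n) * p n y"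
      using F[of n] y by (auto simp: eps_isometric_embedding_def)
    ultimately show ?thesis by linarith
  qed
  moreover have "inj_on f Y"
  proof (rule inj_onI)
    fix x y assume xy: "x \<in> Y" "y \<in> Y" "f x = f y"
    have d: "x - y \<in> Y" using subY xy by (simp add: subspace_diff)
    have "p n (x - y) = 0" for n
    proof -
      have "F n (x - y) = 0"
        using linear_on_diff[OF subY lin_F xy(1,2)] level_f[OF xy(1)] level_f[OF xy(2)] xy(3)
        by (metis cancel_comm_monoid_add_class.diff_cancel)
      then have "inverse (1 + \<epsilon>) * p n (x - y) \<le> 0" using bounds[OF d, of n] by simp
      then have "p n (x - y) \<le> 0" using \<open>0 < \<epsilon>\<close> by (simp add: mult_le_0_iff)
      then show ?thesis using sn d by (simp add: seminorm_on_def order_antisym)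
    qed
    then show "x = y" using frechet_space_separated[OF assms(9) d] by simp
  qed
  ultimately have "frechet_eps_isometric_embedding \<epsilon> Y p (power_seminorm \<pi> j \<kappa>) f"
    by (simp add: frechet_eps_isometric_embedding_def power_seminorm_eq_norm_level level_f)
  moreover have "f x = f0 x" if "x \<in> X" for x
    using that assms(14) by (intro eq_if_levels_eq) (simp add: level_f FX subset_iff)
  ultimately show ?thesis by blast
qed

end
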